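(* The function $f$ has no finite-fold Diophantine representation; that is, there is no polynomial $W(x_1,x_2,x_3,\ldots,x_m)$ with integer coefficients such that for all non-negative integers $x_1,x_2$ one has $x_2=f(x_1)$ (with $x_1\geq 1$) if and only if there exist $x_3,\ldots,x_m\in\mathbb{N}$ with $W(x_1,x_2,x_3,\ldots,x_m)=0$, and such that for all $x_1,x_2\in\mathbb{N}$ the equation $W(x_1,x_2,x_3,\ldots,x_m)=0$ has only finitely many solutions $(x_3,\ldots,x_m)\in\mathbb{N}^{m-2}$.
   Context: $\mathbb{N}=\{0,1,2,\ldots\}$. For a positive integer $n$, let $E_n=\{x_i=1,\ x_i+x_j=x_k,\ x_i\cdot x_j=x_k : i,j,k\in\{1,\ldots,n\}\}$. Let $f(n)$ denote the smallest non-negative integer $b$ such that for each system $S\subseteq E_n$ with a finite number of solutions in integers $x_1,\ldots,x_n$, all these solutions belong to $[-b,b]^n$. A Diophantine representation of a set $\mathcal{M}\subseteq\mathbb{N}^k$ is a polynomial $W(a_1,\ldots,a_k,x_1,\ldots,x_m)$ with integer coefficients such that $(a_1,\ldots,a_k)\in\mathcal{M}$ iff $\exists x_1,\ldots,x_m\in\mathbb{N}\ W(a_1,\ldots,a_k,x_1,\ldots,x_m)=0$; it is finite-fold if for every $(a_1,\ldots,a_k)\in\mathbb{N}^k$ the equation has only finitely many solutions $(x_1,\ldots,x_m)\in\mathbb{N}^m$. A Diophantine representation of a function is one of its graph. *)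

theory Defs
  imports Main "HOL-Library.FuncSet" "HOL-Library.Poly_Mapping"
begin

datatype equation =
    Eq_One nat            \<comment> \<open>\<open>x\<^sub>i = 1\<close>\<close>
  | Eq_Add nat nat nat    \<comment> \<open>\<open>x\<^sub>i + x\<^sub>j = x\<^sub>k\<close>\<close>
  | Eq_Mult nat nat nat   \<comment> \<open>\<open>x\<^sub>i \<cdot> x\<^sub>j = x\<^sub>k\<close>\<close>

fun satisfies :: "(nat \<Rightarrow> int) \<Rightarrow> equation \<Rightarrow> bool" where
  "satisfies x (Eq_One i) \<longleftrightarrow> x i = 1"
| "satisfies x (Eq_Add i j k) \<longleftrightarrow> x i + x j = x k"
| "satisfies x (Eq_Mult i j k) \<longleftrightarrow> x i * x j = x k"

definition E :: "nat \<Rightarrow> equation set" where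
  "E n = {Eq_One i | i. i \<in> {1..n}}
       \<union> {Eq_Add i j k | i j k. i \<in> {1..n} \<and> j \<in> {1..n} \<and> k \<in> {1..n}}
       \<union> {Eq_Mult i j k | i j k. i \<in> {1..n} \<and> j \<in> {1..n} \<and> k \<in> {1..n}}"

text \<open>
  An integer tuple \<open>(x\<^sub>1, \<dots>, x\<^sub>n)\<close> is a function on \<open>{1..n}\<close>, extended by \<open>undefined\<close> outside,
  so that distinct elements of \<open>solutions n S\<close> are distinct tuples and finiteness is meaningful.
\<close>
definition solutions :: "nat \<Rightarrow> equation set \<Rightarrow> (nat \<Rightarrow> int) set" where
  "solutions n S = {x \<in> {1..n} \<rightarrow>\<^sub>E UNIV. \<forall>e\<in>S. satisfies x e}"

definition bounds_finite_systems :: "nat \<Rightarrow> nat \<Rightarrow> bool" where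
  "bounds_finite_systems n b \<longleftrightarrow>
     (\<forall>S\<subseteq>E n. finite (solutions n S) \<longrightarrow>
        (\<forall>x\<in>solutions n S. \<forall>i\<in>{1..n}. x i \<in> {- int b..int b}))"

definition sol_bound :: "nat \<Rightarrow> nat" where
  "sol_bound n = (LEAST b. bounds_finite_systems n b)"

lemma finite_E: "finite (E n)"
proof -
  have "E n \<subseteq> Eq_One ` {1..n}
      \<union> (\<lambda>(i, j, k). Eq_Add i j k) ` ({1..n} \<times> {1..n} \<times> {1..n})
      \<union> (\<lambda>(i, j, k). Eq_Mult i j k) ` ({1..n} \<times> {1..n} \<times> {1..n})"
    unfolding E_def by (auto simp: image_iff) 
  then show ?thesis by (rule finite_subset) auto
qed

text \<open>Some bound exists for every \<open>n\<close>, so the \<open>LEAST\<close> above is attained.\<close>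
lemma bounds_finite_systems_sol_bound: "bounds_finite_systems n (sol_bound n)"
proof -
  define A where "A = (\<Union>S\<in>{S \<in> Pow (E n). finite (solutions n S)}.
      \<Union>x\<in>solutions n S. (\<lambda>i. nat \<bar>x i\<bar>) ` {1..n})"
  have "finite A"
    unfolding A_def using finite_E[of n] by auto
  then obtain b where b: "\<And>a. a \<in> A \<Longrightarrow> a \<le> b"
    by (meson finite_nat_set_iff_bounded_le)
  have "bounds_finite_systems n b"
    unfolding bounds_finite_systems_def
  proof (intro allI impI ballI)
    fix S x i assume "S \<subseteq> E n" "finite (solutions n S)" "x \<in> solutions n S" "i \<in> {1..n}"
    then have "nat \<bar>x i\<bar> \<in> A" unfolding A_def by blast
    from b[OF this] show "x i \<in> {- int b..int b}" by auto
  qed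
  then show ?thesis unfolding sol_bound_def by (rule LeastI)
qed

text \<open>
  Integer polynomials in indeterminates \<open>X\<^sub>0, X\<^sub>1, \<dots>\<close>: finitely supported maps from monomials
  (finitely supported exponent maps) to coefficients.
\<close>
type_synonym int_mpoly = "(nat \<Rightarrow>\<^sub>0 nat) \<Rightarrow>\<^sub>0 int"

definition indets :: "int_mpoly \<Rightarrow> nat set" where
  "indets W = (\<Union>t\<in>Poly_Mapping.keys W. Poly_Mapping.keys t)"

definition eval_mpoly :: "int_mpoly \<Rightarrow> (nat \<Rightarrow> int) \<Rightarrow> int" where
  "eval_mpoly W x = (\<Sum>t\<in>Poly_Mapping.keys W.
     Poly_Mapping.lookup W t * (\<Prod>i\<in>Poly_Mapping.keys t. x i ^ Poly_Mapping.lookup t i))"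

text \<open>
  Tuples of naturals are lists. In the zero set of \<open>W\<close> over parameters \<open>a\<close> of length \<open>k\<close>,
  \<open>X\<^sub>0, \<dots>, X\<^bsub>k-1\<^esub>\<close> stand for the parameters and \<open>X\<^sub>k, \<dots>, X\<^bsub>k+m-1\<^esub>\<close> for the unknowns.
\<close>
definition zeros_over :: "nat \<Rightarrow> int_mpoly \<Rightarrow> nat list \<Rightarrow> nat list set" where
  "zeros_over m W a = {x. length x = m \<and> eval_mpoly W (\<lambda>i. int ((a @ x) ! i)) = 0}"

definition diophantine_representation ::
    "nat \<Rightarrow> nat \<Rightarrow> int_mpoly \<Rightarrow> nat list set \<Rightarrow> bool" where
  "diophantine_representation k m W M \<longleftrightarrow>
     indets W \<subseteq> {..<k + m} \<and>
     (\<forall>a. length a = k \<longrightarrow> (a \<in> M \<longleftrightarrow> (\<exists>x. x \<in> zeros_over m W a)))"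

definition finite_fold_diophantine_representation ::
    "nat \<Rightarrow> nat \<Rightarrow> int_mpoly \<Rightarrow> nat list set \<Rightarrow> bool" where
  "finite_fold_diophantine_representation k m W M \<longleftrightarrow>
     diophantine_representation k m W M \<and>
     (\<forall>a. length a = k \<longrightarrow> finite (zeros_over m W a))"

definition graph_on :: "nat set \<Rightarrow> (nat \<Rightarrow> nat) \<Rightarrow> nat list set" where
  "graph_on D g = {[n, g n] | n. n \<in> D}"

end

theory Submission
  imports Defs "HOL-Computational_Algebra.Primes"
begin

text \<open>
  Suppose \<open>W\<close> were a finite-fold representation of \<open>f\<close>. For fixed \<open>W\<close>, the conditions
  \<open>x\<^sub>1 = 2\<^sup>k\<close> and \<open>W(x\<^sub>1, x\<^sub>2, \<dots>) = 0\<close>, with every other \<open>x\<^sub>j\<close> a sum of four squares to force it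
  to be a natural number, can be written as a system of the equations \<open>x\<^sub>i = 1\<close>,
  \<open>x\<^sub>i + x\<^sub>j = x\<^sub>l\<close>, \<open>x\<^sub>i \<cdot> x\<^sub>j = x\<^sub>l\<close> in \<open>k + O(1)\<close> unknowns, because \<open>2\<^sup>k\<close> is reached by \<open>k\<close> doublings.
  For large \<open>k\<close> there are at most \<open>n = 2\<^sup>k\<close> unknowns. Finite-foldness makes the system finitely
  solvable; it is solvable with \<open>x\<^sub>2 = f(n)\<close>, and a further unknown equal to \<open>x\<^sub>2 + 1\<close> exceeds the
  bound \<open>f(n)\<close>.
\<close>

section \<open>Lagrange's four-square theorem\<close>

definition sum_of_four_squares :: "int \<Rightarrow> bool" where
  "sum_of_four_squares n \<longleftrightarrow> (\<exists>a b c d. n = a\<^sup>2 + b\<^sup>2 + c\<^sup>2 + d\<^sup>2)"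

text \<open>Norms of quaternions multiply: the four terms are the components of the second
  quaternion times the conjugate of the first. With this choice of signs, if (e, f, g, h) is
  congruent to (a, b, c, d), the last three terms vanish modulo m and the first becomes the norm, as
  the descent requires.\<close>

lemma euler_four_square_identity:
  fixes a b c d e f g h :: int
  shows "(a\<^sup>2 + b\<^sup>2 + c\<^sup>2 + d\<^sup>2) * (e\<^sup>2 + f\<^sup>2 + g\<^sup>2 + h\<^sup>2) =
    (a*e + b*f + c*g + d*h)\<^sup>2 + (a*f - b*e + c*h - d*g)\<^sup>2 +
    (a*g - b*h - c*e + d*f)\<^sup>2 + (a*h + b*g - c*f - d*e)\<^sup>2"
  by algebra

lemma sum_of_four_squares_mult:
  "sum_of_four_squares m \<Longrightarrow> sum_of_four_squares n \<Longrightarrow> sum_of_four_squares (m * n)"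
  unfolding sum_of_four_squares_def using euler_four_square_identity by metis

lemma ex_least_abs_residue:
  fixes m x :: int
  assumes "m > 0"
  shows "\<exists>y. m dvd x - y \<and> 2 * \<bar>y\<bar> \<le> m"
proof (cases "2 * (x mod m) \<le> m")
  case True
  then show ?thesis using assms by (intro exI[of _ "x mod m"]) auto
next
  case False
  have "m dvd x - (x mod m - m)"
    by (metis diff_diff_eq2 dvd_add_triv_right_iff dvd_minus_mod diff_add_eq)
  moreover have "x mod m < m" using assms by simp
  ultimately show ?thesis using False by (intro exI[of _ "x mod m - m"]) auto
qed

section \<open>A small multiple of an odd prime as a sum of four squares\<close>

text \<open>Equal squares make p divide (x - y)(x + y), hence one factor; both are smaller than p in
  absolute value, so that factor is 0.\<close>

lemma inj_on_square_mod_prime: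
  fixes p :: int
  assumes "prime p"
  shows "inj_on (\<lambda>x. x\<^sup>2 mod p) {x. 0 \<le> x \<and> 2 * x < p}"
proof (rule inj_onI)
  fix x y assume xy: "x \<in> {x. 0 \<le> x \<and> 2 * x < p}" "y \<in> {x. 0 \<le> x \<and> 2 * x < p}"
    and "x\<^sup>2 mod p = y\<^sup>2 mod p"
  then have "p dvd (x - y) * (x + y)"
    by (simp add: mod_eq_dvd_iff power2_eq_square algebra_simps)
  then have "p dvd x - y \<or> p dvd x + y"
    using assms by (simp add: prime_dvd_mult_iff)
  moreover have "\<bar>x - y\<bar> < p" "0 \<le> x + y" "x + y < p" using xy by auto
  ultimately have "x - y = 0 \<or> x + y = 0"
    by (metis abs_of_nonneg dvd_imp_le_int not_le prime_ge_0_int assms)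
  then show "x = y" using xy by auto
qed

text \<open>Pigeonhole: the squares of 0, ..., (p - 1)/2 and the values -1 - y^2 over the same range
  give (p + 1)/2 residues each. Together that is p + 1, so the two sets meet.\<close>

lemma prime_dvd_sum_two_squares_plus_one:
  fixes p :: int
  assumes "prime p" "odd p"
  shows "\<exists>x y. 2 * \<bar>x\<bar> < p \<and> 2 * \<bar>y\<bar> < p \<and> p dvd x\<^sup>2 + y\<^sup>2 + 1"
proof -
  obtain q where q: "p = 2 * q + 1" using assms(2) by (elim oddE)
  have "p > 1" using assms(1) by (simp add: prime_gt_1_int)
  define A where "A = {x. 0 \<le> x \<and> 2 * x < p}"
  have "A = {0..q}" unfolding A_def q by auto
  then have A: "finite A" "card A = nat (q + 1)" by auto
  define f where "f = (\<lambda>x::int. x\<^sup>2 mod p)"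
  define g where "g = (\<lambda>x::int. (- 1 - x\<^sup>2) mod p)"
  have f: "inj_on f A" unfolding f_def A_def by (rule inj_on_square_mod_prime[OF assms(1)])
  have "inj_on g A"
  proof (rule inj_onI)
    fix x y assume xy: "x \<in> A" "y \<in> A" "g x = g y"
    then have "f x = f y"
      unfolding f_def g_def mod_eq_dvd_iff by (simp add: dvd_diff_commute)
    then show "x = y" using f xy by (meson inj_onD)
  qed
  with f A have card: "card (f ` A) = nat (q + 1)" "card (g ` A) = nat (q + 1)"
    by (auto simp: card_image)
  have "f ` A \<inter> g ` A \<noteq> {}"
  proof
    assume "f ` A \<inter> g ` A = {}"
    then have "card (f ` A \<union> g ` A) = 2 * nat (q + 1)"
      using card A(1) by (subst card_Un_disjoint) auto
    moreover have "f ` A \<union> g ` A \<subseteq> {0..<p}"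
      using \<open>p > 1\<close> by (auto simp: f_def g_def)
    then have "card (f ` A \<union> g ` A) \<le> nat p"
      by (metis card_atLeastLessThan_int card_mono diff_zero finite_atLeastLessThan_int)
    ultimately show False using q \<open>p > 1\<close> by simp
  qed
  then obtain x y where xy: "x \<in> A" "y \<in> A" "f x = g y" by auto
  then have "p dvd x\<^sup>2 + y\<^sup>2 + 1"
    unfolding f_def g_def mod_eq_dvd_iff by (simp add: algebra_simps)
  with xy show ?thesis unfolding A_def by (intro exI[of _ x] exI[of _ y]) auto
qed

lemma small_multiple_of_prime_sum_of_four_squares:
  fixes p :: int
  assumes "prime p" "odd p"
  shows "\<exists>m. 0 < m \<and> m < p \<and> sum_of_four_squares (m * p)"
proof -
  obtain x y where xy: "2 * \<bar>x\<bar> < p" "2 * \<bar>y\<bar> < p" "p dvd x\<^sup>2 + y\<^sup>2 + 1"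
    using prime_dvd_sum_two_squares_plus_one[OF assms] by blast
  then obtain m where m: "x\<^sup>2 + y\<^sup>2 + 1 = m * p" by (metis dvdE mult.commute)
  have p: "p > 1" using assms(1) by (simp add: prime_gt_1_int)
  have "0 < m * p" unfolding m[symmetric] by (simp add: add_nonneg_pos)
  then have "0 < m" using p by (simp add: zero_less_mult_iff)
  \<comment> \<open>Both squares are below p^2/4 and 1 is at most p^2/4, so the sum stays below p^2
    and the cofactor m below p.\<close>
  have "(2 * \<bar>x\<bar>)\<^sup>2 < p\<^sup>2" "(2 * \<bar>y\<bar>)\<^sup>2 < p\<^sup>2"
    using power_strict_mono[OF xy(1), of 2] power_strict_mono[OF xy(2), of 2] by simp_all
  moreover have "4 \<le> p\<^sup>2" using p power_mono[of 2 p 2] by simp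
  ultimately have "m * p < p * p"
    using m by (simp add: power_mult_distrib power2_eq_square)
  then have "m < p" using p by simp
  moreover have "m * p = x\<^sup>2 + y\<^sup>2 + 1\<^sup>2 + 0\<^sup>2" using m by simp
  ultimately show ?thesis using \<open>0 < m\<close> unfolding sum_of_four_squares_def by blast
qed

section \<open>Descent from a multiple of a prime to the prime itself\<close>

text \<open>Replacing a, b, c, d by their least absolute residues modulo m gives a sum of squares N
  = m * r with r at most m. Multiplying mp by mr through Euler's identity yields four squares of
  multiples of m; cancelling m^2 leaves rp. The extreme cases r = 0 and r = m would make m divide
  the prime p.\<close>

lemma four_squares_descent:
  fixes p m :: int
  assumes p: "prime p" and m: "1 < m" "m < p" and sq: "sum_of_four_squares (m * p)"
  shows "\<exists>r. 0 < r \<and> r < m \<and> sum_of_four_squares (r * p)"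
proof -
  have "\<not> m dvd p" using p m by (metis less_le not_less prime_int_iff zero_le_one order.trans)
  obtain a b c d where abcd: "m * p = a\<^sup>2 + b\<^sup>2 + c\<^sup>2 + d\<^sup>2"
    using sq unfolding sum_of_four_squares_def by blast
  have residue: "\<exists>y k. x = y + m * k \<and> 2 * \<bar>y\<bar> \<le> m" for x
  proof -
    obtain y where y: "m dvd x - y" "2 * \<bar>y\<bar> \<le> m"
      using ex_least_abs_residue[of m x] m by auto
    then obtain k where "x - y = m * k" by blast
    with y show ?thesis by (intro exI[of _ y] exI[of _ k]) auto
  qed
  obtain e f g h a' b' c' d'
    where eq: "a = e + m * a'" "b = f + m * b'" "c = g + m * c'" "d = h + m * d'"
      and le: "2 * \<bar>e\<bar> \<le> m" "2 * \<bar>f\<bar> \<le> m" "2 * \<bar>g\<bar> \<le> m" "2 * \<bar>h\<bar> \<le> m"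
    using residue[of a] residue[of b] residue[of c] residue[of d] by blast
  have "(x + m * y)\<^sup>2 = x\<^sup>2 + 2 * (m * x * y) + m * (m * y\<^sup>2)" for x y
    by (simp add: power2_eq_square algebra_simps)
  then have mp: "m * p = (e\<^sup>2 + 2 * (m * e * a') + m * (m * a'\<^sup>2))
      + (f\<^sup>2 + 2 * (m * f * b') + m * (m * b'\<^sup>2))
      + (g\<^sup>2 + 2 * (m * g * c') + m * (m * c'\<^sup>2))
      + (h\<^sup>2 + 2 * (m * h * d') + m * (m * d'\<^sup>2))"
    unfolding abcd eq by simp
  define N where "N = e\<^sup>2 + f\<^sup>2 + g\<^sup>2 + h\<^sup>2"
  have "N = m * (p - 2*(e*a' + f*b' + g*c' + h*d') - m*(a'\<^sup>2 + b'\<^sup>2 + c'\<^sup>2 + d'\<^sup>2))"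
    using mp unfolding N_def by (simp add: algebra_simps)
  then obtain r where r: "N = m * r" by blast
  have sq_le: "4 * e\<^sup>2 \<le> m\<^sup>2" "4 * f\<^sup>2 \<le> m\<^sup>2" "4 * g\<^sup>2 \<le> m\<^sup>2" "4 * h\<^sup>2 \<le> m\<^sup>2"
    using le[THEN power_mono, of 2] by (simp_all add: power_mult_distrib)
  have "r \<ge> 0"
  proof -
    have "N \<ge> 0" unfolding N_def by simp
    then show ?thesis using r m by (simp add: zero_le_mult_iff)
  qed
  \<comment> \<open>All residues would be 0, so m^2 would divide mp.\<close>
  moreover have "r \<noteq> 0"
  proof
    assume "r = 0"
    then have "e = 0" "f = 0" "g = 0" "h = 0"
      using r sum_power2_eq_zero_iff unfolding N_def
      by (auto simp: add_nonneg_eq_0_iff)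
    then have "m * p = m * (m * (a'\<^sup>2 + b'\<^sup>2 + c'\<^sup>2 + d'\<^sup>2))"
      unfolding mp by (simp add: algebra_simps)
    with m have "p = m * (a'\<^sup>2 + b'\<^sup>2 + c'\<^sup>2 + d'\<^sup>2)" by simp
    with \<open>\<not> m dvd p\<close> show False by simp
  qed
  moreover have "r \<le> m"
  proof -
    have "m * r \<le> m * m"
      using sq_le unfolding r[symmetric] N_def by (simp add: power2_eq_square)
    then show ?thesis using m by simp
  qed
  \<comment> \<open>Each residue would have absolute value exactly m/2, the boundary case allowed by
    the non-strict bound on residues.\<close>
  moreover have "r \<noteq> m"
  proof
    assume "r = m"
    then have "e\<^sup>2 + f\<^sup>2 + g\<^sup>2 + h\<^sup>2 = m\<^sup>2"
      using r unfolding N_def by (simp add: power2_eq_square)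
    with sq_le have half: "(2*e)\<^sup>2 = m\<^sup>2" "(2*f)\<^sup>2 = m\<^sup>2" "(2*g)\<^sup>2 = m\<^sup>2" "(2*h)\<^sup>2 = m\<^sup>2"
      by (auto simp: power_mult_distrib)
    \<comment> \<open>The cross terms 2mxy are multiples of m^2 because 2x is m or -m; with N = m^2,
      every contribution to mp is then divisible by m^2.\<close>
    have mult: "\<exists>i. 2 * (m * x * y) = m * m * i" if "(2*x)\<^sup>2 = m\<^sup>2" for x y :: int
    proof -
      from that have "2*x = m \<or> 2*x = - m" unfolding power2_eq_iff .
      then have "m * (2*x) * y = m * m * y \<or> m * (2*x) * y = m * m * (- y)"
        by (elim disjE) (simp_all only: mult_minus_left mult_minus_right simp_thms)
      moreover have "2 * (m * x * y) = m * (2*x) * y" by simp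
      ultimately show ?thesis by metis
    qed
    obtain i1 i2 i3 i4 where i: "2 * (m * e * a') = m * m * i1" "2 * (m * f * b') = m * m * i2"
      "2 * (m * g * c') = m * m * i3" "2 * (m * h * d') = m * m * i4"
      using mult half by metis
    have "m * p = m * (m * (1 + i1 + i2 + i3 + i4 + a'\<^sup>2 + b'\<^sup>2 + c'\<^sup>2 + d'\<^sup>2))"
    proof -
      have "m * p = (e\<^sup>2 + f\<^sup>2 + g\<^sup>2 + h\<^sup>2) + m * m * i1 + m * m * i2 + m * m * i3 + m * m * i4
          + m * m * (a'\<^sup>2 + b'\<^sup>2 + c'\<^sup>2 + d'\<^sup>2)"
        unfolding mp i by (simp add: distrib_left)
      then show ?thesis
        unfolding \<open>e\<^sup>2 + f\<^sup>2 + g\<^sup>2 + h\<^sup>2 = m\<^sup>2\<close>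
        by (simp add: power2_eq_square[of m] distrib_left mult.assoc)
    qed
    with m have "p = m * (1 + i1 + i2 + i3 + i4 + a'\<^sup>2 + b'\<^sup>2 + c'\<^sup>2 + d'\<^sup>2)" by simp
    with \<open>\<not> m dvd p\<close> show False by simp
  qed
  moreover have "sum_of_four_squares (r * p)"
  proof -
    have "m dvd a*e + b*f + c*g + d*h"
    proof -
      have "a*e + b*f + c*g + d*h = N + m * (a'*e + b'*f + c'*g + d'*h)"
        unfolding N_def eq by algebra
      then show ?thesis by (simp add: r)
    qed
    moreover have "m dvd a*f - b*e + c*h - d*g"
    proof -
      have "a*f - b*e + c*h - d*g = m * (a'*f - b'*e + c'*h - d'*g)" unfolding eq by algebra
      then show ?thesis by simp
    qed
    moreover have "m dvd a*g - b*h - c*e + d*f"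
    proof -
      have "a*g - b*h - c*e + d*f = m * (a'*g - b'*h - c'*e + d'*f)" unfolding eq by algebra
      then show ?thesis by simp
    qed
    moreover have "m dvd a*h + b*g - c*f - d*e"
    proof -
      have "a*h + b*g - c*f - d*e = m * (a'*h + b'*g - c'*f - d'*e)" unfolding eq by algebra
      then show ?thesis by simp
    qed
    ultimately obtain s t u v where "a*e + b*f + c*g + d*h = m * s"
      "a*f - b*e + c*h - d*g = m * t" "a*g - b*h - c*e + d*f = m * u"
      "a*h + b*g - c*f - d*e = m * v" by (elim dvdE) blast
    then have "(m * p) * (m * r) = (m*s)\<^sup>2 + (m*t)\<^sup>2 + (m*u)\<^sup>2 + (m*v)\<^sup>2"
      unfolding abcd r[symmetric] N_def using euler_four_square_identity[of a b c d e f g h] by simp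
    also have "\<dots> = (m * m) * (s\<^sup>2 + t\<^sup>2 + u\<^sup>2 + v\<^sup>2)" by algebra
    finally have "(m * m) * (r * p) = (m * m) * (s\<^sup>2 + t\<^sup>2 + u\<^sup>2 + v\<^sup>2)"
      by (simp add: algebra_simps)
    then have "r * p = s\<^sup>2 + t\<^sup>2 + u\<^sup>2 + v\<^sup>2" using m by simp
    then show ?thesis unfolding sum_of_four_squares_def by blast
  qed
  ultimately show ?thesis by (intro exI[of _ r]) auto
qed

lemma prime_sum_of_four_squares:
  fixes p :: int
  assumes "prime p"
  shows "sum_of_four_squares p"
proof (cases "odd p")
  case False
  then have "p = 2" using assms primes_dvd_imp_eq[of 2 p] by auto
  then have "p = 1\<^sup>2 + 1\<^sup>2 + 0\<^sup>2 + 0\<^sup>2" by simp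
  then show ?thesis unfolding sum_of_four_squares_def by blast
next
  case True
  \<comment> \<open>Strong induction on the multiplier: the descent lowers m until it reaches
    1.\<close>
  have "0 < m \<Longrightarrow> m < p \<Longrightarrow> sum_of_four_squares (m * p) \<Longrightarrow> sum_of_four_squares p" for m
  proof (induction "nat m" arbitrary: m rule: less_induct)
    case less
    show ?case
    proof (cases "m = 1")
      case False
      then obtain r where "0 < r" "r < m" "sum_of_four_squares (r * p)"
        using four_squares_descent[OF assms, of m] less.prems by auto
      then show ?thesis using less by auto
    qed (use less in simp)
  qed
  then show ?thesis
    using small_multiple_of_prime_sum_of_four_squares[OF assms True] by blast
qed

lemma lagrange_four_squares: "sum_of_four_squares (int n)"
proof (induction n rule: prime_divisors_induct)
  case zero
  have "int 0 = 0\<^sup>2 + 0\<^sup>2 + 0\<^sup>2 + 0\<^sup>2" by simp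
  then show ?case unfolding sum_of_four_squares_def by blast
next
  case (unit n)
  then have "int n = 1\<^sup>2 + 0\<^sup>2 + 0\<^sup>2 + 0\<^sup>2" by simp
  then show ?case unfolding sum_of_four_squares_def by blast
next
  case (factor p n)
  then show ?case
    by (simp add: sum_of_four_squares_mult prime_sum_of_four_squares)
qed

section \<open>Arithmetic expressions and systems of equations\<close>

text \<open>Constants other than 1 and powers are left out, so that each compound node matches a
  single equation of \<open>E n\<close>.\<close>

datatype 'v expr =
    Var 'v
  | One
  | Add "'v expr" "'v expr"
  | Sub "'v expr" "'v expr"
  | Mul "'v expr" "'v expr"

primrec eval_expr :: "('v \<Rightarrow> int) \<Rightarrow> 'v expr \<Rightarrow> int" where
  "eval_expr s (Var v) = s v"
| "eval_expr s One = 1"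
| "eval_expr s (Add a b) = eval_expr s a + eval_expr s b"
| "eval_expr s (Sub a b) = eval_expr s a - eval_expr s b"
| "eval_expr s (Mul a b) = eval_expr s a * eval_expr s b"

primrec subexprs :: "'v expr \<Rightarrow> 'v expr set" where
  "subexprs (Var v) = {Var v}"
| "subexprs One = {One}"
| "subexprs (Add a b) = insert (Add a b) (subexprs a \<union> subexprs b)"
| "subexprs (Sub a b) = insert (Sub a b) (subexprs a \<union> subexprs b)"
| "subexprs (Mul a b) = insert (Mul a b) (subexprs a \<union> subexprs b)"

lemma finite_subexprs [simp]: "finite (subexprs e)"
  by (induction e) auto

lemma self_in_subexprs [simp]: "e \<in> subexprs e"
  by (cases e) auto

lemma subexprs_trans: "t \<in> subexprs e \<Longrightarrow> subexprs t \<subseteq> subexprs e"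
  by (induction e) auto

lemma Var_in_subexprs_iff: "Var v \<in> subexprs e \<longleftrightarrow> v \<in> set_expr e"
  by (induction e) auto

section \<open>Polynomials as arithmetic expressions\<close>

text \<open>\<open>eval_mpoly\<close> sums and multiplies over finite sets without a chosen order.
  Asking only that some expression exists lets closure properties replace an explicit
  construction.\<close>

definition expressible :: "'v set \<Rightarrow> (('v \<Rightarrow> int) \<Rightarrow> int) \<Rightarrow> bool" where
  "expressible J F \<longleftrightarrow> (\<exists>e. set_expr e \<subseteq> J \<and> (\<forall>s. eval_expr s e = F s))"

lemma expressible_Var: "v \<in> J \<Longrightarrow> expressible J (\<lambda>s. s v)"
  unfolding expressible_def by (intro exI[of _ "Var v"]) auto

lemma expressible_add:
  assumes "expressible J F" "expressible J G"
  shows "expressible J (\<lambda>s. F s + G s)"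
proof -
  obtain a b where "set_expr a \<subseteq> J" "\<forall>s. eval_expr s a = F s"
    "set_expr b \<subseteq> J" "\<forall>s. eval_expr s b = G s"
    using assms unfolding expressible_def by blast
  then show ?thesis unfolding expressible_def by (intro exI[of _ "Add a b"]) auto
qed

lemma expressible_diff:
  assumes "expressible J F" "expressible J G"
  shows "expressible J (\<lambda>s. F s - G s)"
proof -
  obtain a b where "set_expr a \<subseteq> J" "\<forall>s. eval_expr s a = F s"
    "set_expr b \<subseteq> J" "\<forall>s. eval_expr s b = G s"
    using assms unfolding expressible_def by blast
  then show ?thesis unfolding expressible_def by (intro exI[of _ "Sub a b"]) auto
qed

lemma expressible_mult:
  assumes "expressible J F" "expressible J G"
  shows "expressible J (\<lambda>s. F s * G s)"
proof -
  obtain a b where "set_expr a \<subseteq> J" "\<forall>s. eval_expr s a = F s"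
    "set_expr b \<subseteq> J" "\<forall>s. eval_expr s b = G s"
    using assms unfolding expressible_def by blast
  then show ?thesis unfolding expressible_def by (intro exI[of _ "Mul a b"]) auto
qed

lemma expressible_one: "expressible J (\<lambda>s. 1)"
  unfolding expressible_def by (intro exI[of _ One]) auto

lemma expressible_const: "expressible J (\<lambda>s. c)"
proof (induction c rule: int_induct[where k = 1])
  case base
  show ?case by (rule expressible_one)
next
  case (step1 i)
  show ?case by (rule expressible_add[OF step1(2) expressible_one])
next
  case (step2 i)
  show ?case by (rule expressible_diff[OF step2(2) expressible_one])
qed

lemma expressible_power: "expressible J F \<Longrightarrow> expressible J (\<lambda>s. F s ^ n)"
  by (induction n) (auto intro: expressible_one expressible_mult)

lemma expressible_sum:
  "(\<And>i. i \<in> I \<Longrightarrow> expressible J (F i)) \<Longrightarrow> expressible J (\<lambda>s. \<Sum>i\<in>I. F i s)"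
  by (induction I rule: infinite_finite_induct) (auto intro: expressible_const expressible_add)

lemma expressible_prod:
  "(\<And>i. i \<in> I \<Longrightarrow> expressible J (F i)) \<Longrightarrow> expressible J (\<lambda>s. \<Prod>i\<in>I. F i s)"
  by (induction I rule: infinite_finite_induct) (auto intro: expressible_one expressible_mult)

lemma expressible_eval_mpoly:
  assumes "\<And>i. i \<in> indets W \<Longrightarrow> v i \<in> J"
  shows "expressible J (\<lambda>s. eval_mpoly W (\<lambda>i. s (v i)))"
  unfolding eval_mpoly_def
proof (intro expressible_sum expressible_mult expressible_const expressible_prod
    expressible_power expressible_Var)
  fix t i assume "t \<in> Poly_Mapping.keys W" "i \<in> Poly_Mapping.keys t"
  then show "v i \<in> J" using assms unfolding indets_def by blast
qed

section \<open>From expressions to systems of equations\<close>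

lemma satisfies_cong:
  assumes "e \<in> E n" "\<And>i. i \<in> {1..n} \<Longrightarrow> x i = y i"
  shows "satisfies x e \<longleftrightarrow> satisfies y e"
  using assms unfolding E_def by auto

text \<open>Here \<open>h\<close> numbers the unknowns. A variable stays free, and a difference is
  written as an addition with the minuend as result.\<close>

fun defining_equation :: "('v expr \<Rightarrow> nat) \<Rightarrow> 'v expr \<Rightarrow> equation set" where
  "defining_equation h (Var v) = {}"
| "defining_equation h One = {Eq_One (h One)}"
| "defining_equation h (Add a b) = {Eq_Add (h a) (h b) (h (Add a b))}"
| "defining_equation h (Sub a b) = {Eq_Add (h (Sub a b)) (h b) (h a)}"
| "defining_equation h (Mul a b) = {Eq_Mult (h a) (h b) (h (Mul a b))}"

text \<open>A solution is thus determined on \<open>T\<close> by its values at the variables, so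
  bounding these is enough to get finitely many solutions.\<close>

lemma eval_expr_of_solution:
  assumes closed: "\<And>t. t \<in> T \<Longrightarrow> subexprs t \<subseteq> T"
    and sat: "\<And>t e. t \<in> T \<Longrightarrow> e \<in> defining_equation h t \<Longrightarrow> satisfies x e"
    and "t \<in> T"
  shows "x (h t) = eval_expr (\<lambda>v. x (h (Var v))) t"
  using \<open>t \<in> T\<close>
proof (induction t)
  case (Add a b)
  moreover have "a \<in> T" "b \<in> T" using closed[OF Add.prems] by auto
  ultimately show ?case using sat[OF Add.prems] by simp
next
  case (Sub a b)
  moreover have "a \<in> T" "b \<in> T" using closed[OF Sub.prems] by auto
  ultimately show ?case using sat[OF Sub.prems] by simp
next
  case (Mul a b)
  moreover have "a \<in> T" "b \<in> T" using closed[OF Mul.prems] by auto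
  ultimately show ?case using sat[OF Mul.prems] by simp
qed (use sat in force)+

text \<open>
  Each expression in \<open>T\<close> becomes one unknown, defined by one equation from its immediate
  subexpressions; \<open>z = 0\<close> becomes \<open>z + z = z\<close>, and superfluous unknowns are set to \<open>1\<close>.
\<close>
lemma eval_expr_le_sol_bound:
  fixes T :: "'v expr set"
  assumes fin: "finite T" and closed: "\<And>t. t \<in> T \<Longrightarrow> subexprs t \<subseteq> T"
    and Z: "Z \<subseteq> T" and n: "card T \<le> n"
    and bounded: "\<And>s v. (\<And>z. z \<in> Z \<Longrightarrow> eval_expr s z = 0) \<Longrightarrow> Var v \<in> T \<Longrightarrow> \<bar>s v\<bar> \<le> B"
    and s: "\<And>z. z \<in> Z \<Longrightarrow> eval_expr s z = 0" and t: "t \<in> T"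
  shows "\<bar>eval_expr s t\<bar> \<le> int (sol_bound n)"
proof -
  obtain h where h: "bij_betw h T {1..card T}"
    using fin by (metis finite_same_card_bij finite_atLeastAtMost card_atLeastAtMost
        add_diff_cancel_right' Suc_eq_plus1)
  have h_in: "h t \<in> {1..n}" if "t \<in> T" for t
    using bij_betwE[OF h] that n by fastforce
  define S where "S = (\<Union>t\<in>T. defining_equation h t) \<union> (\<lambda>z. Eq_Add (h z) (h z) (h z)) ` Z
    \<union> Eq_One ` {card T<..n}"
  have children: "Add a b \<in> T \<Longrightarrow> a \<in> T \<and> b \<in> T" "Sub a b \<in> T \<Longrightarrow> a \<in> T \<and> b \<in> T"
    "Mul a b \<in> T \<Longrightarrow> a \<in> T \<and> b \<in> T" for a b
    using closed[of "Add a b"] closed[of "Sub a b"] closed[of "Mul a b"]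
      self_in_subexprs[of a] self_in_subexprs[of b] by auto
  have "defining_equation h t \<subseteq> E n" if "t \<in> T" for t
  proof (cases t)
    case (Add a b)
    then have "h a \<in> {1..n}" "h b \<in> {1..n}" "h t \<in> {1..n}"
      using that children by (blast intro: h_in)+
    then show ?thesis unfolding Add E_def by auto
  next
    case (Sub a b)
    then have "h a \<in> {1..n}" "h b \<in> {1..n}" "h t \<in> {1..n}"
      using that children by (blast intro: h_in)+
    then show ?thesis unfolding Sub E_def by auto
  next
    case (Mul a b)
    then have "h a \<in> {1..n}" "h b \<in> {1..n}" "h t \<in> {1..n}"
      using that children by (blast intro: h_in)+
    then show ?thesis unfolding Mul E_def by auto
  next
    case One
    then show ?thesis using h_in[OF that] unfolding One E_def by auto
  qed simp
  moreover have "Eq_Add (h z) (h z) (h z) \<in> E n" if "z \<in> Z" for z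
    using h_in[of z] that Z unfolding E_def by blast
  moreover have "Eq_One i \<in> E n" if "i \<in> {card T<..n}" for i
    using that unfolding E_def by auto
  ultimately have S: "S \<subseteq> E n" unfolding S_def by blast
  have val: "x (h t) = eval_expr (\<lambda>v. x (h (Var v))) t" if "x \<in> solutions n S" "t \<in> T" for x t
    using that by (intro eval_expr_of_solution[of T]) (auto simp: solutions_def S_def closed)
  have zero: "eval_expr (\<lambda>v. x (h (Var v))) z = 0" if "x \<in> solutions n S" "z \<in> Z" for x z
  proof -
    have "satisfies x (Eq_Add (h z) (h z) (h z))"
      using that unfolding solutions_def S_def by blast
    then show ?thesis using val[of x z] that Z by auto
  qed
  have bnd: "\<bar>x (h (Var v))\<bar> \<le> B" if "x \<in> solutions n S" "Var v \<in> T" for x v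
    using bounded[OF zero[OF that(1)] that(2)] .
  define vars where "vars = {v. Var v \<in> T}"
  define \<Phi> where "\<Phi> = (\<lambda>x :: nat \<Rightarrow> int. restrict (\<lambda>v. x (h (Var v))) vars)"
  \<comment> \<open>The projection \<open>\<Phi>\<close> to the variables lands in a finite box by
    \<open>bnd\<close>. It is injective since the variables determine all unknowns numbered by
    \<open>h\<close> and the padding unknowns equal 1.\<close>
  have "finite (solutions n S)"
  proof (rule finite_imageD)
    have "finite vars"
      unfolding vars_def using finite_vimageI[OF fin, of Var] by (simp add: inj_def vimage_def)
    then have "finite (vars \<rightarrow>\<^sub>E {- B..B})" by (intro finite_PiE) auto
    moreover have "\<Phi> ` solutions n S \<subseteq> vars \<rightarrow>\<^sub>E {- B..B}"
      using bnd unfolding \<Phi>_def vars_def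
      by (auto simp: abs_le_iff minus_le_iff intro!: restrict_PiE_iff[THEN iffD2])
    ultimately show "finite (\<Phi> ` solutions n S)" by (rule rev_finite_subset)
    show "inj_on \<Phi> (solutions n S)"
    proof (rule inj_onI)
      fix x y assume x: "x \<in> solutions n S" and y: "y \<in> solutions n S" and eq: "\<Phi> x = \<Phi> y"
      have vars_eq: "x (h (Var v)) = y (h (Var v))" if "Var v \<in> T" for v
        using fun_cong[OF eq, of v] that by (simp add: \<Phi>_def vars_def)
      have eval_eq: "x (h t) = y (h t)" if "t \<in> T" for t
      proof -
        have "eval_expr (\<lambda>v. x (h (Var v))) u = eval_expr (\<lambda>v. y (h (Var v))) u"
          if "subexprs u \<subseteq> T" for u using that by (induction u) (auto simp: vars_eq)
        then show ?thesis using val x y closed that by metis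
      qed
      have "x i = y i" if "i \<in> {1..n}" for i
      proof (cases "i \<le> card T")
        case True
        then have "i \<in> h ` T" using bij_betw_imp_surj_on[OF h] that by simp
        then obtain t where "t \<in> T" "i = h t" by blast
        then show ?thesis using eval_eq by simp
      next
        case False
        then have "Eq_One i \<in> S" using that unfolding S_def by auto
        then have "satisfies x (Eq_One i)" "satisfies y (Eq_One i)"
          using x y unfolding solutions_def by blast+
        then show ?thesis by simp
      qed
      then show "x = y"
        using x y unfolding solutions_def by (blast intro: PiE_ext)
    qed
  qed
  \<comment> \<open>Conversely, the assignment \<open>s\<close> yields a solution: each unknown
    receives the value of its expression, and padding receives 1.\<close>
  define g where "g = (\<lambda>i. if i \<le> card T then eval_expr s (inv_into T h i) else 1)"
  have g_h: "g (h t) = eval_expr s t" if "t \<in> T" for t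
    using bij_betwE[OF h] that bij_betw_inv_into_left[OF h that] by (auto simp: g_def)
  \<comment> \<open>Members of \<open>solutions\<close> are \<open>undefined\<close> outside
    \<open>{1..n}\<close>; restricting \<open>g\<close> achieves this without affecting equations of
    \<open>E n\<close>.\<close>
  define y where "y = restrict g {1..n}"
  have "satisfies g e" if "e \<in> S" for e
  proof -
    have "satisfies g e" if "t \<in> T" "e \<in> defining_equation h t" for t
    proof (cases t)
      case (Add a b)
      then show ?thesis using that children(1)[of a b] g_h[of a] g_h[of b] g_h[of t] by simp
    next
      case (Sub a b)
      then show ?thesis using that children(2)[of a b] g_h[of a] g_h[of b] g_h[of t] by simp
    next
      case (Mul a b)
      then show ?thesis using that children(3)[of a b] g_h[of a] g_h[of b] g_h[of t] by simp
    qed (use that g_h[of t] in simp_all)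
    moreover have "satisfies g (Eq_Add (h z) (h z) (h z))" if "z \<in> Z" for z
      using s[OF that] g_h[of z] that Z by auto
    moreover have "satisfies g (Eq_One i)" if "i \<in> {card T<..n}" for i
      using that by (simp add: g_def)
    ultimately show ?thesis using that unfolding S_def by blast
  qed
  moreover have "satisfies y e \<longleftrightarrow> satisfies g e" if "e \<in> S" for e
    using that S by (intro satisfies_cong[of _ n]) (auto simp: y_def)
  ultimately have "y \<in> solutions n S" unfolding solutions_def y_def by auto
  then have "y (h t) \<in> {- int (sol_bound n)..int (sol_bound n)}"
    using bounds_finite_systems_sol_bound[of n] S \<open>finite (solutions n S)\<close> h_in[OF t]
    unfolding bounds_finite_systems_def by blast
  moreover have "y (h t) = eval_expr s t" using g_h h_in t by (simp add: y_def)
  ultimately show ?thesis by auto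
qed

section \<open>Powers of two by repeated doubling\<close>

primrec pow2_expr :: "nat \<Rightarrow> 'v expr" where
  "pow2_expr 0 = One"
| "pow2_expr (Suc k) = Add (pow2_expr k) (pow2_expr k)"

lemma eval_pow2_expr [simp]: "eval_expr s (pow2_expr k) = 2 ^ k"
  by (induction k) auto

lemma set_pow2_expr [simp]: "set_expr (pow2_expr k) = {}"
  by (induction k) auto

text \<open>Both summands of a doubling are the same expression, so the set of subexpressions grows
  by at most one each time, although the tree doubles.\<close>

lemma card_subexprs_pow2_expr: "card (subexprs (pow2_expr k)) \<le> Suc k"
proof (induction k)
  case (Suc k)
  then show ?case
    using card_insert_le_m1[of "Suc (Suc k)" "subexprs (pow2_expr k)"] by simp
qed simp

section \<open>The contradiction\<close>

text \<open>The unknown \<open>(j, 0)\<close> stands for \<open>X\<^sub>j\<close>, and \<open>(j, 1), \<dots>, (j, 4)\<close> for the roots of its four squares.\<close>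
definition four_squares_expr :: "nat \<Rightarrow> (nat \<times> nat) expr" where
  "four_squares_expr j = (let sq = (\<lambda>i. Mul (Var (j, i)) (Var (j, i))) in
     Sub (Var (j, 0)) (Add (Add (sq 1) (sq 2)) (Add (sq 3) (sq 4))))"

lemma eval_four_squares_expr:
  "eval_expr s (four_squares_expr j) =
     s (j, 0) - ((s (j, 1))\<^sup>2 + (s (j, 2))\<^sup>2 + ((s (j, 3))\<^sup>2 + (s (j, 4))\<^sup>2))"
  by (simp add: four_squares_expr_def Let_def power2_eq_square)

lemma set_four_squares_expr: "set_expr (four_squares_expr j) = {j} \<times> {0, 1, 2, 3, 4}"
  by (auto simp: four_squares_expr_def Let_def)

lemma abs_le_power2_int: "\<bar>x::int\<bar> \<le> x\<^sup>2"
proof (cases "x = 0")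
  case False
  then have "\<bar>x\<bar> * 1 \<le> \<bar>x\<bar> * \<bar>x\<bar>" by (intro mult_left_mono) auto
  then show ?thesis by (simp add: power2_eq_square)
qed simp

text \<open>The case i = 0 says that X_j is non-negative; the other cases bound the roots, so a
  bound on X_j controls all five variables.\<close>

lemma abs_four_squares_le:
  assumes "eval_expr s (four_squares_expr j) = 0" "i \<in> {0, 1, 2, 3, 4}"
  shows "\<bar>s (j, i)\<bar> \<le> s (j, 0)"
proof -
  have "s (j, 0) = (s (j, 1))\<^sup>2 + (s (j, 2))\<^sup>2 + (s (j, 3))\<^sup>2 + (s (j, 4))\<^sup>2"
    using assms(1) by (simp add: eval_four_squares_expr)
  moreover have "\<bar>s (j, i)\<bar> \<le> (s (j, i))\<^sup>2" for i by (rule abs_le_power2_int)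
  moreover have "0 \<le> (s (j, i))\<^sup>2" for i by simp
  ultimately show ?thesis
    using assms(2) by (smt (verit) empty_iff insert_iff)
qed

lemma eval_mpoly_cong:
  assumes "\<And>i. i \<in> indets W \<Longrightarrow> x i = y i"
  shows "eval_mpoly W x = eval_mpoly W y"
  unfolding eval_mpoly_def using assms
  by (intro sum.cong prod.cong arg_cong2[of _ _ _ _ "(*)"] arg_cong2[of _ _ _ _ "(^)"])
    (auto simp: indets_def)

theorem theorem2:
  "\<not> (\<exists>(m::nat) (W::int_mpoly).
        finite_fold_diophantine_representation 2 m W (graph_on {1..} sol_bound))"
proof
  assume "\<exists>m W. finite_fold_diophantine_representation 2 m W (graph_on {1..} sol_bound)"
  then obtain m W where indets: "indets W \<subseteq> {..<m + 2}"
    and repr: "\<And>a. length a = 2 \<Longrightarrow>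
      a \<in> graph_on {1..} sol_bound \<longleftrightarrow> (\<exists>x. x \<in> zeros_over m W a)"
    and finite_fold: "\<And>a. length a = 2 \<Longrightarrow> finite (zeros_over m W a)"
    unfolding finite_fold_diophantine_representation_def diophantine_representation_def
    by (auto simp: add.commute)
  have "expressible (indets W \<times> {0}) (\<lambda>s. eval_mpoly W (\<lambda>i. s (i, 0::nat)))"
    by (rule expressible_eval_mpoly) simp
  then obtain w :: "(nat \<times> nat) expr" where w: "set_expr w \<subseteq> indets W \<times> {0}"
    and eval_w: "\<And>s. eval_expr s w = eval_mpoly W (\<lambda>i. s (i, 0))"
    unfolding expressible_def by blast
  \<comment> \<open>Indices start at 0: X_0 is the argument of f and X_1 its value. \<open>A\<close>
    depends on \<open>W\<close> and \<open>m\<close> only, so its size is fixed before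
    \<open>k\<close> is chosen. X_0 gets no four squares here because \<open>N\<close> will fix it
    to \<open>n\<close>.\<close>
  define A where "A = subexprs w \<union> (\<Union>j\<in>{1..<m + 2}. subexprs (four_squares_expr j))
    \<union> subexprs (Add (Var (1, 0)) One)"
  have "finite A" unfolding A_def by auto
  \<comment> \<open>With c = \<open>card A\<close>, \<open>N\<close> adds at most k + 3
    subexpressions, so \<open>T\<close> has at most 2c + 6 elements; this is at most 8 * 2^c =
    2^k.\<close>
  define k where "k = card A + 3"
  define n :: nat where "n = 2 ^ k"
  define N :: "(nat \<times> nat) expr" where "N = Sub (Var (0, 0)) (pow2_expr k)"
  define T where "T = A \<union> subexprs N"
  define Z where "Z = {w, N} \<union> four_squares_expr ` {1..<m + 2}"
  define a where "a = [n, sol_bound n]"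
  have "card T \<le> n"
  proof -
    have "card (subexprs N) \<le> k + 3"
      using card_subexprs_pow2_expr[of k, where ?'a = "nat \<times> nat"]
      unfolding N_def by (simp add: card_insert_if)
    then have "card T \<le> card A + (k + 3)"
      unfolding T_def using card_Un_le[of A "subexprs N"] by linarith
    moreover have "card A < 2 ^ card A" by (rule less_exp)
    ultimately have "card T \<le> 8 * 2 ^ card A" unfolding k_def by linarith
    then show ?thesis unfolding n_def k_def by (simp add: power_add)
  qed
  have "a \<in> graph_on {1..} sol_bound" unfolding graph_on_def a_def n_def by auto
  then obtain x where x: "x \<in> zeros_over m W a" using repr[of a] by (auto simp: a_def)
  have "finite (zeros_over m W a)" using finite_fold[of a] by (simp add: a_def)
  then have "finite (\<Union>x\<in>zeros_over m W a. set (a @ x))" by blast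
  then obtain B where B: "\<And>x y. x \<in> zeros_over m W a \<Longrightarrow> y \<in> set (a @ x) \<Longrightarrow> y \<le> B"
    unfolding finite_nat_set_iff_bounded_le by blast
  \<comment> \<open>X_1 is itself an unknown of the system, while finite-foldness speaks of fixed
    parameters. So the representation comes first: a common zero with X_0 = n has its parameters on
    the graph, which forces X_1 = f(n). Then the tuple lies in the finite set bounded by
    \<open>B\<close>, and the roots are bounded by their X_j.\<close>
  have bounded: "\<bar>s v\<bar> \<le> int B" if zero: "\<And>z. z \<in> Z \<Longrightarrow> eval_expr s z = 0" and v: "Var v \<in> T"
    for s v
  proof -
    have s0: "s (0, 0) = int n"
      using zero[of N] by (simp add: Z_def N_def n_def)
    have roots: "\<bar>s (j, i)\<bar> \<le> s (j, 0)" if "j \<in> {1..<m + 2}" "i \<in> {0, 1, 2, 3, 4}" for i j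
      using that zero[of "four_squares_expr j"] by (intro abs_four_squares_le) (auto simp: Z_def)
    have nonneg: "s (j, 0) \<ge> 0" if "j < m + 2" for j
      using that s0 roots[of j 0] by (cases "j = 0") auto
    define l where "l = map (\<lambda>j. nat (s (j, 0))) [0..<m + 2]"
    have l: "length l = m + 2" "\<And>j. j < m + 2 \<Longrightarrow> int (l ! j) = s (j, 0)"
      using nonneg unfolding l_def by (auto simp del: upt_Suc)
    have "eval_mpoly W (\<lambda>i. int (l ! i)) = eval_mpoly W (\<lambda>i. s (i, 0))"
      using indets l by (intro eval_mpoly_cong) auto
    also have "\<dots> = 0" using zero[of w] by (simp add: Z_def eval_w)
    finally have zeros: "drop 2 l \<in> zeros_over m W (take 2 l)"
      using l(1) by (simp add: zeros_over_def)
    then have "take 2 l \<in> graph_on {1..} sol_bound" using repr[of "take 2 l"] l(1) by auto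
    then obtain n' where n': "take 2 l = [n', sol_bound n']" unfolding graph_on_def by auto
    then have "l ! 0 = n'" using l(1) by (metis nth_Cons_0 nth_take zero_less_numeral)
    then have "take 2 l = a" using n' l(2)[of 0] s0 unfolding a_def by simp
    with zeros have "y \<le> B" if "y \<in> set l" for y
      using B[of "drop 2 l" y] that by (metis append_take_drop_id)
    then have le_B: "s (j, 0) \<le> int B" if "j < m + 2" for j
      using l that by (metis nth_mem of_nat_le_iff)
    obtain j i where ji: "v = (j, i)" by (cases v)
    have "j < m + 2 \<and> i = 0 \<or> j \<in> {1..<m + 2} \<and> i \<in> {0, 1, 2, 3, 4}"
      using v w indets
      by (auto simp: ji T_def A_def N_def Var_in_subexprs_iff set_four_squares_expr)
    then show ?thesis
      using roots[of j i] nonneg[of j] le_B[of j] unfolding ji by fastforce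
  qed
  define val where "val = (\<lambda>j. int ((a @ x) ! j))"
  \<comment> \<open>Lagrange's theorem extends the zero \<open>x\<close> of \<open>W\<close> by
    suitable roots to a solution of the whole system.\<close>
  have "\<forall>j. \<exists>b c d e. val j = b\<^sup>2 + c\<^sup>2 + d\<^sup>2 + e\<^sup>2"
    using lagrange_four_squares unfolding val_def sum_of_four_squares_def by blast
  then obtain b c d e where val: "\<And>j. val j = (b j)\<^sup>2 + (c j)\<^sup>2 + (d j)\<^sup>2 + (e j)\<^sup>2" by metis
  define s where "s = (\<lambda>(j, i). [val j, b j, c j, d j, e j] ! i)"
  have s: "s (j, 0) = val j" for j by (simp add: s_def)
  have "eval_expr s N = 0" by (simp add: N_def s val_def a_def n_def)
  moreover have "eval_expr s (four_squares_expr j) = 0" for j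
    using val[of j] by (simp add: eval_four_squares_expr s_def eval_nat_numeral)
  moreover have "eval_expr s w = 0"
    using x unfolding eval_w s val_def zeros_over_def by simp
  ultimately have zero: "\<And>z. z \<in> Z \<Longrightarrow> eval_expr s z = 0" unfolding Z_def by blast
  \<comment> \<open>The bound f(n) holds for every expression in \<open>T\<close>, hence for X_1 +
    1, whose value here is f(n) + 1.\<close>
  have "\<bar>eval_expr s (Add (Var (1, 0)) One)\<bar> \<le> int (sol_bound n)"
  proof (rule eval_expr_le_sol_bound[where T = T and Z = Z and B = "int B"])
    show "finite T" unfolding T_def using \<open>finite A\<close> by simp
    show "subexprs t \<subseteq> T" if "t \<in> T" for t
      using that subexprs_trans unfolding T_def A_def by blast
    show "Z \<subseteq> T" unfolding Z_def T_def A_def using self_in_subexprs by blast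
    show "Add (Var (1, 0)) One \<in> T" unfolding T_def A_def by simp
  qed (fact \<open>card T \<le> n\<close> bounded zero)+
  moreover have "eval_expr s (Add (Var (1, 0)) One) = int (sol_bound n) + 1"
    by (simp add: s val_def a_def)
  ultimately show False by simp
qed

end
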